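(* For $m\in\mathbb{N}$ with $m\equiv1\pmod 2$ and $n\in\mathbb{N}\cup\{0\}$, \[ 2^{n-1}\bigl(E_n(m)+E_n\bigr)=\sum_{l=0}^{m-1}(-1)^l(2l+1)^n. \]
   Context: The type 2 Euler polynomials $E_n(x)$ are defined by $\frac{2}{e^{t/2}+e^{-t/2}}e^{xt}=\sum_{n\ge0}E_n(x)\frac{t^n}{n!}$, and $E_n=E_n(0)$. *)

theory Defs
  imports Complex_Main "HOL-Computational_Algebra.Formal_Power_Series" "HOL-Number_Theory.Cong"
begin

definition type2_euler_gf :: "real \<Rightarrow> real fps" where
  "type2_euler_gf x = 2 / (fps_exp (1/2) + fps_exp (-1/2)) * fps_exp x"

definition type2_euler_poly :: "nat \<Rightarrow> real \<Rightarrow> real" where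
  "type2_euler_poly n x = fact n * fps_nth (type2_euler_gf x) n"

definition type2_euler_number :: "nat \<Rightarrow> real" where
  "type2_euler_number n = type2_euler_poly n 0"

(* The denominator has constant term 2, so the quotient of formal power series is exact. *)
lemma type2_euler_gf_exact:
  "(fps_exp (1/2) + fps_exp (-1/2)) * type2_euler_gf x = 2 * fps_exp x"
proof -
  let ?d = "fps_exp (1/2) + fps_exp (-1/2) :: real fps"
  have "fps_nth ?d 0 \<noteq> 0" by simp
  then have "?d * (2 / ?d) = 2"
    by (simp add: fps_divide_unit inverse_mult_eq_1' mult.left_commute)
  then show ?thesis
    unfolding type2_euler_gf_def by (metis mult.assoc)
qed

lemma type2_euler_gf_egf:
  "type2_euler_gf x = Abs_fps (\<lambda>n. type2_euler_poly n x / fact n)"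
  by (simp add: fps_eq_iff type2_euler_poly_def)

end

theory Submission
  imports Defs
begin

text \<open>Since \<open>e^((x+1)t) + e^(xt) = (e^(t/2) + e^(-t/2)) e^((x+1/2)t)\<close>, the
  denominator of the generating function cancels, so \<open>E_n(x+1) + E_n(x) = 2 (x+1/2)^n\<close>
  (\<open>type2_euler_poly_plus_1\<close>). Summing over x = 0, ..., m-1 with alternating signs
  telescopes (\<open>alternating_sum_type2_euler_poly\<close>); for odd m the ends add up to
  \<open>E_n(m) + E_n\<close>, and the factor \<open>2^(n-1)\<close> clears the halves.\<close>

lemma type2_euler_poly_plus_1:
  "type2_euler_poly n (x + 1) + type2_euler_poly n x = 2 * (x + 1/2) ^ n"
proof -
  let ?d = "fps_exp (1/2) + fps_exp (-1/2) :: real fps"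
  have "type2_euler_gf (x + 1) + type2_euler_gf x
      = 2 / ?d * (fps_exp (x + 1) + fps_exp x)"
    by (simp add: type2_euler_gf_def algebra_simps)
  also have "fps_exp (x + 1) + fps_exp x = ?d * fps_exp (x + 1/2)"
    by (simp add: distrib_right add.commute flip: fps_exp_add_mult)
  \<comment> \<open>Only reorders factors, so that the exactness of the quotient does the
    cancelling.\<close>
  also have "2 / ?d * (?d * fps_exp (x + 1/2)) = ?d * type2_euler_gf (x + 1/2)"
    by (simp only: type2_euler_gf_def mult.left_commute)
  also have "\<dots> = 2 * fps_exp (x + 1/2)"
    by (rule type2_euler_gf_exact)
  finally have "fps_nth (type2_euler_gf (x + 1) + type2_euler_gf x) n
      = fps_nth (2 * fps_exp (x + 1/2)) n"
    by simp
  then show ?thesis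
    by (simp add: type2_euler_poly_def numeral_fps_const field_simps)
qed

text \<open>Telescoping; the parity of \<open>k\<close> only fixes the sign at the upper
  end.\<close>

lemma alternating_sum_type2_euler_poly:
  "(\<Sum>l<k. (-1) ^ l * (2 * (real l + 1/2) ^ n))
     = type2_euler_number n - (-1) ^ k * type2_euler_poly n (real k)"
proof (induction k)
  case 0
  then show ?case by (simp add: type2_euler_number_def)
next
  case (Suc k)
  have "2 * (real k + 1/2) ^ n
      = type2_euler_poly n (real (Suc k)) + type2_euler_poly n (real k)"
    using type2_euler_poly_plus_1[of n "real k"] by (simp add: add.commute)
  then show ?case
    by (simp only: sum.lessThan_Suc Suc.IH) (simp add: algebra_simps)
qed

theorem theorem2p11:
  fixes m n :: nat
  assumes "[m = 1] (mod 2)"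
  shows "2 powi (int n - 1) * (type2_euler_poly n (real m) + type2_euler_number n)
       = (\<Sum>l = 0..m - 1. (-1) ^ l * (2 * real l + 1) ^ n)"
proof -
  from assms have "odd m"
    by (simp add: cong_def odd_iff_mod_2_eq_one)
  \<comment> \<open>Oddness gives \<open>m > 0\<close>; at \<open>m = 0\<close>, truncated
    subtraction would leave the index 0 on the left.\<close>
  then have range: "{0..m - 1} = {..<m}"
    using odd_pos[of m] by auto
  \<comment> \<open>The exponent is an integer, so \<open>n = 0\<close> correctly gives 1/2.\<close>
  have scale: "2 powi (int n - 1) = (2 ^ n / 2 :: real)"
    by (simp add: power_int_diff)
  have summand: "2 ^ n * (real l + 1/2) ^ n = (2 * real l + 1) ^ n" for l
    by (simp add: distrib_left flip: power_mult_distrib)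
  have "type2_euler_poly n (real m) + type2_euler_number n
      = (\<Sum>l<m. (-1) ^ l * (2 * (real l + 1/2) ^ n))"
    using \<open>odd m\<close> by (simp add: alternating_sum_type2_euler_poly)
  then show ?thesis
    unfolding range scale
    by (simp add: sum_distrib_left mult.left_commute flip: summand)
qed

end
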